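(* Let $p$ be a prime. The Ramanujan $\tau$ function satisfies the identity $$\tau(p^{m+n})=\tau(p^m)\tau(p^n)-p^{11}\tau(p^{m-1})\tau(p^{n-1}),\qquad m,n\ge1.$$
   Context: The Ramanujan $\tau$ function is the arithmetic function defined by $\sum_{k=1}^{\infty}\tau(k)x^k=x\prod_{k=1}^{\infty}(1-x^k)^{24}$ for $|x|<1$. *)

theory Defs
  imports
    "HOL-Complex_Analysis.Complex_Analysis"
    "HOL-Computational_Algebra.Primes"
begin

(* The generating identity determines the values at k >= 1 only; the value 0 at k = 0 is a
   convention that makes the description unique.  Existence and uniqueness are proved below
   (ramanujan_tau_ex1), so that the definite description is meaningful. *)
definition ramanujan_tau :: "nat \<Rightarrow> int" where
  "ramanujan_tau = (THE t. t 0 = 0 \<and>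
     (\<forall>x::complex. norm x < 1 \<longrightarrow>
        (\<lambda>k. of_int (t (Suc k)) * x ^ Suc k) sums (x * (\<Prod>k. (1 - x ^ Suc k) ^ 24))))"

lemma convergent_prod_one_minus_power:
  fixes x :: complex
  assumes "norm x < 1"
  shows "convergent_prod (\<lambda>k. 1 - x ^ Suc k)"
proof -
  have "summable (\<lambda>k. norm (x ^ Suc k))"
    using assms by (simp add: norm_power norm_mult summable_mult summable_geometric)
  then have "abs_convergent_prod (\<lambda>k. 1 - x ^ Suc k)"
    by (intro summable_imp_abs_convergent_prod) simp
  then show ?thesis
    by (rule abs_convergent_prod_imp_convergent_prod)
qed

lemma uniform_limit_prod_one_minus_power:
  assumes "0 \<le> r" "r < 1"
  shows "uniform_limit (cball 0 r) (\<lambda>n x. \<Prod>k<n. 1 - x ^ Suc k)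
           (\<lambda>x::complex. \<Prod>k. 1 - x ^ Suc k) sequentially"
proof -
  have "uniformly_convergent_on (cball 0 r) (\<lambda>N x::complex. \<Sum>n<N. norm ((1 - x ^ Suc n) - 1))"
  proof (rule Weierstrass_m_test')
    fix n and x :: complex
    assume "x \<in> cball 0 r"
    then have "norm x ^ Suc n \<le> r ^ Suc n"
      by (intro power_mono) auto
    then show "norm (norm ((1 - x ^ Suc n) - 1)) \<le> r ^ Suc n"
      by (simp add: norm_power norm_mult)
  next
    show "summable (\<lambda>n. r ^ Suc n)"
      using assms by (simp add: summable_mult summable_geometric)
  qed
  then have "uniformly_convergent_on (cball 0 r) (\<lambda>N x::complex. \<Prod>n<N. 1 - x ^ Suc n)"
    by (intro uniformly_convergent_on_prod' continuous_intros) auto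
  then have ul: "uniform_limit (cball 0 r) (\<lambda>n x::complex. \<Prod>k<n. 1 - x ^ Suc k)
               (\<lambda>x. lim (\<lambda>n. \<Prod>k<n. 1 - x ^ Suc k)) sequentially"
    using uniformly_convergent_uniform_limit_iff by blast
  have eq: "lim (\<lambda>n. \<Prod>k<n. 1 - x ^ Suc k) = (\<Prod>k. 1 - x ^ Suc k)"
    if "x \<in> cball 0 r" for x :: complex
  proof -
    have "convergent_prod (\<lambda>k. 1 - x ^ Suc k)"
      using that assms by (intro convergent_prod_one_minus_power) auto
    then show ?thesis
      by (intro limI has_prod_imp_tendsto' convergent_prod_has_prod)
  qed
  show ?thesis
    by (rule uniform_limit_cong'[THEN iffD1, OF refl eq ul])
qed

lemma holomorphic_prodinf_one_minus_power:
  "(\<lambda>x::complex. \<Prod>k. 1 - x ^ Suc k) holomorphic_on ball 0 1"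
proof (rule holomorphic_uniform_sequence[where f = "\<lambda>n x. \<Prod>k<n. 1 - x ^ Suc k"])
  fix x :: complex
  assume x: "x \<in> ball 0 1"
  define d where "d = (1 - norm x) / 2"
  have "cball x d \<subseteq> cball 0 (norm x + d)"
    by (simp add: cball_subset_cball_iff dist_norm)
  moreover have "uniform_limit (cball 0 (norm x + d)) (\<lambda>n x. \<Prod>k<n. 1 - x ^ Suc k)
           (\<lambda>x::complex. \<Prod>k. 1 - x ^ Suc k) sequentially"
    using x by (intro uniform_limit_prod_one_minus_power) (auto simp: d_def field_simps)
  moreover have "cball 0 (norm x + d) \<subseteq> ball (0::complex) 1"
    using x by (auto simp: d_def field_simps)
  moreover have "d > 0"
    using x by (simp add: d_def)
  ultimately show "\<exists>d>0. cball x d \<subseteq> ball 0 1 \<and>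
      uniform_limit (cball x d) (\<lambda>n x. \<Prod>k<n. 1 - x ^ Suc k) (\<lambda>x. \<Prod>k. 1 - x ^ Suc k) sequentially"
    by (meson order_trans uniform_limit_on_subset)
qed (auto intro!: holomorphic_intros)

lemma fps_nth_mult_Ints:
  fixes F G :: "'a :: comm_ring_1 fps"
  assumes "\<And>n. fps_nth F n \<in> \<int>" "\<And>n. fps_nth G n \<in> \<int>"
  shows "fps_nth (F * G) n \<in> \<int>"
  unfolding fps_mult_nth by (intro Ints_sum Ints_mult assms)

lemma fps_nth_power_Ints:
  fixes F :: "'a :: comm_ring_1 fps"
  assumes "\<And>n. fps_nth F n \<in> \<int>"
  shows "fps_nth (F ^ m) n \<in> \<int>"
proof (induction m arbitrary: n)
  case 0
  then show ?case by (simp add: fps_one_def)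
next
  case (Suc m)
  then show ?case using assms by (simp add: fps_nth_mult_Ints)
qed

lemma fps_nth_prod_Ints:
  fixes F :: "'b \<Rightarrow> 'a :: comm_ring_1 fps"
  assumes "\<And>i n. fps_nth (F i) n \<in> \<int>"
  shows "fps_nth (\<Prod>i\<in>A. F i) n \<in> \<int>"
proof (induction A arbitrary: n rule: infinite_finite_induct)
  case (insert a A)
  then show ?case using assms by (simp add: fps_nth_mult_Ints)
qed (simp_all add: fps_one_def)

lemma fps_expansion_prodinf_one_minus_power_Ints:
  "fps_nth (fps_expansion (\<lambda>x::complex. \<Prod>k. 1 - x ^ Suc k) 0) m \<in> \<int>"
proof -
  define f where "f = (\<lambda>n (x::complex). \<Prod>k<n. 1 - x ^ Suc k)"
  define g where "g = (\<lambda>x::complex. \<Prod>k. 1 - x ^ Suc k)"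
  have "uniform_limit (ball 0 (1/2)) f g sequentially"
    unfolding f_def g_def
    by (rule uniform_limit_on_subset[OF uniform_limit_prod_one_minus_power[of "1/2"]]) auto
  then have "(\<lambda>n. (deriv ^^ m) (f n) 0) \<longlonglongrightarrow> (deriv ^^ m) g 0"
    by (rule higher_deriv_complex_uniform_limit)
       (auto simp: f_def intro!: always_eventually holomorphic_intros)
  then have "(\<lambda>n. (deriv ^^ m) (f n) 0 / fact m) \<longlonglongrightarrow> (deriv ^^ m) g 0 / fact m"
    by (intro tendsto_intros) auto
  moreover have "(deriv ^^ m) (f n) 0 / fact m \<in> \<int>" for n
  proof -
    have "f n has_fps_expansion (\<Prod>k<n. 1 - fps_X ^ Suc k)"
      unfolding f_def by (intro fps_expansion_intros)
    then have "(deriv ^^ m) (f n) 0 / fact m = fps_nth (\<Prod>k<n. 1 - fps_X ^ Suc k) m"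
      by (simp add: fps_nth_fps_expansion)
    also have "\<dots> \<in> \<int>"
      by (rule fps_nth_prod_Ints) (auto simp del: power_Suc)
    finally show ?thesis .
  qed
  ultimately have "(deriv ^^ m) g 0 / fact m \<in> \<int>"
    by (rule closed_sequentially[OF closed_Ints, of "\<lambda>n. (deriv ^^ m) (f n) 0 / fact m", rotated])
  then show ?thesis
    by (simp add: fps_expansion_def g_def)
qed

lemma ramanujan_tau_ex1:
  "\<exists>!t :: nat \<Rightarrow> int. t 0 = 0 \<and>
     (\<forall>x::complex. norm x < 1 \<longrightarrow>
        (\<lambda>k. of_int (t (Suc k)) * x ^ Suc k) sums (x * (\<Prod>k. (1 - x ^ Suc k) ^ 24)))"
proof -
  define g where "g = (\<lambda>x::complex. \<Prod>k. 1 - x ^ Suc k)"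
  define h where "h = (\<lambda>x. x * g x ^ 24)"
  have h_eq: "x * (\<Prod>k. (1 - x ^ Suc k) ^ 24) = h x" if "norm x < 1" for x
    using prodinf_power[OF convergent_prod_one_minus_power[OF that], of 24]
    by (simp add: h_def g_def)
  have holg: "g holomorphic_on ball 0 1"
    unfolding g_def by (rule holomorphic_prodinf_one_minus_power)
  then have holh: "h holomorphic_on ball 0 1"
    unfolding h_def by (intro holomorphic_intros)
  have g_exp: "g has_fps_expansion fps_expansion g 0"
    using holg by (intro has_fps_expansion_fps_expansion[of "ball 0 1"]) auto
  define H where "H = fps_X * fps_expansion g 0 ^ 24"
  have h_exp: "h has_fps_expansion H"
    unfolding h_def H_def by (intro fps_expansion_intros g_exp)
  have "fps_nth H n \<in> \<int>" for n
    unfolding H_def g_def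
    by (intro fps_nth_mult_Ints fps_nth_power_Ints fps_expansion_prodinf_one_minus_power_Ints)
       (auto simp: fps_X_def)
  then have "\<forall>n. \<exists>k. fps_nth H n = of_int k"
    by (auto simp: Ints_def)
  then obtain t where t: "\<And>n. fps_nth H n = of_int (t n)"
    by metis
  have t0: "t 0 = 0"
    using t[of 0] by (simp add: H_def)
  have sums_iff: "(\<lambda>k. of_int (s (Suc k)) * x ^ Suc k) sums y \<longleftrightarrow> (\<lambda>k. of_int (s k) * x ^ k) sums y"
    if "s 0 = 0" for s :: "nat \<Rightarrow> int" and x y :: complex
    using that sums_Suc_iff[of "\<lambda>k. of_int (s k) * x ^ k" y] by simp
  show ?thesis
  proof (rule ex1I[of _ t], intro conjI allI impI)
    fix x :: complex
    assume x: "norm x < 1"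
    have "(\<lambda>n. (deriv ^^ n) h 0 / fact n * (x - 0) ^ n) sums h x"
      using holh x by (intro holomorphic_power_series[of _ _ 1]) auto
    then have "(\<lambda>n. of_int (t n) * x ^ n) sums h x"
      by (simp add: t[symmetric] fps_nth_fps_expansion[OF h_exp])
    then show "(\<lambda>k. of_int (t (Suc k)) * x ^ Suc k) sums (x * (\<Prod>k. (1 - x ^ Suc k) ^ 24))"
      unfolding h_eq[OF x] sums_iff[of t, OF t0] .
  next
    fix s :: "nat \<Rightarrow> int"
    assume s: "s 0 = 0 \<and> (\<forall>x::complex. norm x < 1 \<longrightarrow>
        (\<lambda>k. of_int (s (Suc k)) * x ^ Suc k) sums (x * (\<Prod>k. (1 - x ^ Suc k) ^ 24)))"
    have "(\<lambda>k. of_int (s k) * x ^ k) sums h x" if "norm x < 1" for x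
    proof -
      have "(\<lambda>k. of_int (s (Suc k)) * x ^ Suc k) sums h x"
        using s that unfolding h_eq[OF that, symmetric] by blast
      moreover have "s 0 = 0"
        using s by blast
      ultimately show ?thesis
        using sums_iff[of s x] by blast
    qed
    then have "eventually (\<lambda>x. (\<lambda>k. fps_nth (Abs_fps (\<lambda>k. of_int (s k))) k * x ^ k) sums h x) (nhds 0)"
      unfolding eventually_nhds by (intro exI[of _ "ball 0 1"]) simp
    then have "h has_fps_expansion Abs_fps (\<lambda>k. of_int (s k))"
      by (rule has_fps_expansionI)
    then have "Abs_fps (\<lambda>k. of_int (s k)) = H"
      using h_exp by (rule fps_expansion_unique_complex)
    then have "complex_of_int (s n) = of_int (t n)" for n
      by (metis fps_nth_Abs_fps t)
    then show "s = t"
      by auto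
  qed (rule t0)
qed

lemma ramanujan_tau_0: "ramanujan_tau 0 = 0"
  and ramanujan_tau_sums:
    "norm (x::complex) < 1 \<Longrightarrow>
       (\<lambda>k. of_int (ramanujan_tau (Suc k)) * x ^ Suc k) sums (x * (\<Prod>k. (1 - x ^ Suc k) ^ 24))"
  using theI'[OF ramanujan_tau_ex1, folded ramanujan_tau_def] by simp_all

end

theory Submission
  imports Defs
begin

text \<open>
  Write \<open>\<Delta>(z) = q \<Prod>(1 - q^n)^24\<close> with \<open>q = exp(2 \<pi> i z)\<close>.

  Modularity of \<open>\<Delta>\<close>: the product \<open>\<theta>(w) = (1 - x) \<Prod>(1 - q^n x)(1 - q^n / x)\<close> with
  \<open>x = exp(2 \<pi> i w)\<close> has its zeros at the lattice spanned by 1 and \<open>z\<close>, and so has its counterpart for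
  \<open>-1/z\<close> taken at \<open>w/z\<close>.  After a Gaussian factor their quotient is doubly periodic, hence
  equal to a constant \<open>C\<close> by Liouville's theorem.  The limit at \<open>w = 0\<close> expresses \<open>C\<close> by the products
  \<open>\<Prod>(1 - q^n)^2\<close>, while multiplying the values at the three half periods shows that \<open>C^3\<close> is an explicit
  exponential, since \<open>\<Prod>(1 + q^n)(1 - q^(n-1/2))(1 + q^(n-1/2)) = 1\<close>.  Comparing both gives
  \<open>\<Delta>(-1/z) = z^12 \<Delta>(z)\<close>.

  Mordell's argument: \<open>T_p \<Delta>\<close> has weight 12 too, so \<open>T_p \<Delta> / \<Delta>\<close> is an invariant function that is
  holomorphic in \<open>q\<close> on the unit disc.  As every orbit meets \<open>Im z \<ge> 1/2\<close>, its modulus attains its maximum,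
  so it is constant, namely \<open>\<tau>(p)\<close>.  Comparing coefficients gives
  \<open>\<tau>(p n) + p^11 \<tau>(n/p) = \<tau>(p) \<tau>(n)\<close>.
\<close>

section \<open>The q-Pochhammer symbol\<close>

text \<open>The infinite product (x; q) of q-series. The index starts at 0, so
  \<open>qpoch q q\<close> is the product of all 1 - q^n with n \<ge> 1.\<close>

definition qpoch :: "complex \<Rightarrow> complex \<Rightarrow> complex" where
  "qpoch q x = (\<Prod>k. 1 - x * q ^ k)"

lemma convergent_prod_qpoch:
  fixes q x :: complex
  assumes "norm q < 1"
  shows "convergent_prod (\<lambda>k. 1 - x * q ^ k)"
proof -
  have "summable (\<lambda>k. norm (- (x * q ^ k)))"
    using assms by (simp add: norm_power norm_mult summable_mult summable_geometric)
  then have "abs_convergent_prod (\<lambda>k. 1 + - (x * q ^ k))"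
    by (intro summable_imp_abs_convergent_prod) simp
  then show ?thesis
    using abs_convergent_prod_imp_convergent_prod by simp
qed

lemma qpoch_LIMSEQ:
  assumes "norm q < 1"
  shows "(\<lambda>n. \<Prod>k<n. 1 - x * q ^ k) \<longlonglongrightarrow> qpoch q x"
  unfolding qpoch_def
  by (intro has_prod_imp_tendsto' convergent_prod_has_prod convergent_prod_qpoch assms)

lemma qpoch_rec:
  assumes "norm q < 1"
  shows "qpoch q x = (1 - x) * qpoch q (x * q)"
proof -
  have "(\<lambda>n. (1 - x) * (\<Prod>k<n. 1 - x * q * q ^ k)) \<longlonglongrightarrow> (1 - x) * qpoch q (x * q)"
    by (intro tendsto_intros qpoch_LIMSEQ assms)
  also have "(\<lambda>n. (1 - x) * (\<Prod>k<n. 1 - x * q * q ^ k)) = (\<lambda>n. \<Prod>k<Suc n. 1 - x * q ^ k)"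
    by (subst prod.lessThan_Suc_shift) (simp add: mult_ac)
  finally show ?thesis
    using LIMSEQ_Suc[OF qpoch_LIMSEQ[OF assms]] LIMSEQ_unique by blast
qed

lemma qpoch_nonzero:
  assumes "norm q < 1" "\<And>k. x * q ^ k \<noteq> 1"
  shows "qpoch q x \<noteq> 0"
  unfolding qpoch_def using assms(2) by (intro prodinf_nonzero convergent_prod_qpoch assms(1)) (metis eq_iff_diff_eq_0)

lemma qpoch_nonzero':
  assumes "norm q < 1" "norm x < 1"
  shows "qpoch q x \<noteq> 0"
proof (rule qpoch_nonzero[OF assms(1)])
  fix k
  have "norm (x * q ^ k) \<le> norm x"
    using assms by (simp add: norm_mult norm_power mult_left_le power_le_one)
  then show "x * q ^ k \<noteq> 1"
    using assms by auto
qed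

lemma qpoch_zero_left [simp]: "qpoch q 0 = 1"
  by (simp add: qpoch_def)

lemma qpoch_mult_minus:
  assumes "norm q < 1"
  shows "qpoch q x * qpoch q (- x) = qpoch (q\<^sup>2) (x\<^sup>2)"
proof -
  have "norm (q\<^sup>2) < 1"
    using assms by (simp add: norm_power power_less_one_iff abs_square_less_1)
  have "(\<lambda>n. (\<Prod>k<n. 1 - x * q ^ k) * (\<Prod>k<n. 1 - (- x) * q ^ k)) \<longlonglongrightarrow> qpoch q x * qpoch q (- x)"
    by (intro tendsto_intros qpoch_LIMSEQ assms)
  also have "(\<lambda>n. (\<Prod>k<n. 1 - x * q ^ k) * (\<Prod>k<n. 1 - (- x) * q ^ k)) =
      (\<lambda>n. \<Prod>k<n. 1 - x\<^sup>2 * (q\<^sup>2) ^ k)"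
    by (simp add: prod.distrib[symmetric] algebra_simps power2_eq_square power_mult_distrib)
  finally show ?thesis
    using qpoch_LIMSEQ[OF \<open>norm (q\<^sup>2) < 1\<close>] LIMSEQ_unique by blast
qed

text \<open>Factors of even index run through powers of q^2, those of odd index carry one more q; up
  to n each, they form the partial product of length 2n.\<close>

lemma qpoch_even_odd:
  assumes "norm q < 1"
  shows "qpoch (q\<^sup>2) x * qpoch (q\<^sup>2) (x * q) = qpoch q x"
proof -
  have q2: "norm (q\<^sup>2) < 1"
    using assms by (simp add: norm_power power_less_one_iff abs_square_less_1)
  have "(\<lambda>n. (\<Prod>k<n. 1 - x * (q\<^sup>2) ^ k) * (\<Prod>k<n. 1 - x * q * (q\<^sup>2) ^ k)) \<longlonglongrightarrow>
      qpoch (q\<^sup>2) x * qpoch (q\<^sup>2) (x * q)"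
    by (intro tendsto_intros qpoch_LIMSEQ q2)
  moreover have "(\<Prod>k<n. 1 - x * (q\<^sup>2) ^ k) * (\<Prod>k<n. 1 - x * q * (q\<^sup>2) ^ k) = (\<Prod>k<2*n. 1 - x * q ^ k)" for n
    by (induction n) (simp_all add: algebra_simps flip: power_mult)
  moreover have "(\<lambda>n. \<Prod>k<2*n. 1 - x * q ^ k) \<longlonglongrightarrow> qpoch q x"
    using LIMSEQ_subseq_LIMSEQ[OF qpoch_LIMSEQ[OF assms], of "\<lambda>n. 2 * n"]
    by (simp add: strict_mono_def o_def)
  ultimately show ?thesis
    using LIMSEQ_unique by simp
qed

text \<open>Equivalent to Euler's identity between partitions into distinct parts and into odd parts.\<close>
lemma qpoch_triple_product_one:
  assumes "norm r < 1"
  shows "qpoch (r\<^sup>2) (- (r\<^sup>2)) * (qpoch (r\<^sup>2) r * qpoch (r\<^sup>2) (- r)) = 1"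
proof -
  define q where "q = r\<^sup>2"
  have q: "norm q < 1" "norm (q\<^sup>2) < 1"
    using assms by (simp_all add: q_def norm_power power_less_one_iff abs_square_less_1)
  \<comment> \<open>After multiplication by \<open>qpoch q q\<close>, the arguments r and -r pair
    up, and so do q and -q. The two results are the odd and even halves of \<open>qpoch q q\<close>,
    which is nonzero and cancels.\<close>
  have "qpoch q (- q) * (qpoch q r * qpoch q (- r)) * qpoch q q = qpoch (q\<^sup>2) q * qpoch (q\<^sup>2) (q\<^sup>2)"
    using qpoch_mult_minus[OF q(1), of r] qpoch_mult_minus[OF q(1), of q] by (simp add: q_def mult_ac)
  also have "\<dots> = qpoch q q"
    using qpoch_even_odd[OF q(1), of q] by (simp add: power2_eq_square)
  finally show ?thesis
    using qpoch_nonzero'[OF q(1) q(1)] by (simp add: q_def)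
qed

text \<open>On a disc of radius R the terms x q^n are dominated by R |q|^n, so the partial products
  converge locally uniformly in x.\<close>

lemma holomorphic_qpoch:
  assumes "norm q < 1"
  shows "qpoch q holomorphic_on A"
proof -
  have ul: "uniform_limit (cball 0 R) (\<lambda>n x. \<Prod>k<n. 1 - x * q ^ k) (qpoch q) sequentially" for R
  proof -
    have "uniformly_convergent_on (cball 0 R) (\<lambda>N x. \<Sum>n<N. norm ((1 - x * q ^ n) - 1))"
    proof (rule Weierstrass_m_test')
      fix n and x :: complex
      assume "x \<in> cball 0 R"
      then show "norm (norm ((1 - x * q ^ n) - 1)) \<le> R * norm q ^ n"
        by (simp add: norm_power norm_mult mult_right_mono)
    qed (use assms in \<open>simp add: summable_mult summable_geometric\<close>)
    then have "uniformly_convergent_on (cball 0 R) (\<lambda>N x. \<Prod>n<N. 1 - x * q ^ n)"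
      by (intro uniformly_convergent_on_prod' continuous_intros) auto
    then have "uniform_limit (cball 0 R) (\<lambda>n x. \<Prod>k<n. 1 - x * q ^ k)
                 (\<lambda>x. lim (\<lambda>n. \<Prod>k<n. 1 - x * q ^ k)) sequentially"
      using uniformly_convergent_uniform_limit_iff by blast
    then show ?thesis
      by (rule uniform_limit_cong'[THEN iffD1, rotated 2])
         (auto intro!: limI qpoch_LIMSEQ assms)
  qed
  have "qpoch q holomorphic_on UNIV"
  proof (rule holomorphic_uniform_sequence[where f = "\<lambda>n x. \<Prod>k<n. 1 - x * q ^ k"])
    fix x :: complex
    have "cball x 1 \<subseteq> cball 0 (norm x + 1)"
      by (simp add: cball_subset_cball_iff dist_norm)
    then show "\<exists>d>0. cball x d \<subseteq> UNIV \<and>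
        uniform_limit (cball x d) (\<lambda>n x. \<Prod>k<n. 1 - x * q ^ k) (qpoch q) sequentially"
      using ul uniform_limit_on_subset zero_less_one by blast
  qed (auto intro!: holomorphic_intros)
  then show ?thesis
    using holomorphic_on_subset by blast
qed

lemma holomorphic_on_qpoch [holomorphic_intros]:
  assumes "norm q < 1" "f holomorphic_on A"
  shows "(\<lambda>w. qpoch q (f w)) holomorphic_on A"
  using holomorphic_on_compose[OF assms(2) holomorphic_qpoch[OF assms(1)]] by (simp add: o_def)

lemma tendsto_qpoch [tendsto_intros]:
  assumes "norm q < 1" "(f \<longlongrightarrow> c) F"
  shows "((\<lambda>w. qpoch q (f w)) \<longlongrightarrow> qpoch q c) F"
proof (rule isCont_tendsto_compose[OF _ assms(2)])
  show "isCont (qpoch q) c"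
    using holomorphic_on_imp_continuous_on[OF holomorphic_qpoch[OF assms(1), of UNIV]]
    by (simp add: continuous_on_eq_continuous_at)
qed

section \<open>Doubly periodic functions\<close>

definition period_lattice :: "complex \<Rightarrow> complex set" where
  "period_lattice z = {of_int m + of_int n * z | m n. True}"

text \<open>The imaginary part forces the coefficient of z to vanish, and then the modulus forces
  the other one to. Applied to differences, this makes the lattice discrete.\<close>

lemma period_lattice_norm_less_imp_0:
  assumes "l \<in> period_lattice z" "norm l < min 1 (Im z)"
  shows "l = 0"
proof -
  obtain m n :: int where l: "l = of_int m + of_int n * z"
    using assms by (auto simp: period_lattice_def)
  have "\<bar>of_int n * Im z\<bar> < Im z"
    using abs_Im_le_cmod[of l] assms(2) l by simp
  moreover have "Im z > 0"
    using assms(2) norm_ge_zero[of l] by linarith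
  ultimately have "n = 0"
    by (simp add: abs_mult)
  with l assms(2) have "\<bar>of_int m :: real\<bar> < 1"
    by simp
  then have "m = 0"
    by linarith
  with l \<open>n = 0\<close> show ?thesis
    by simp
qed

lemma period_lattice_diff: "l \<in> period_lattice z \<Longrightarrow> l' \<in> period_lattice z \<Longrightarrow> l - l' \<in> period_lattice z"
  unfolding period_lattice_def
  by (clarsimp) (metis add_diff_add left_diff_distrib of_int_diff)

lemma period_lattice_0 [simp]: "0 \<in> period_lattice z"
  unfolding period_lattice_def by (auto intro!: exI[of _ 0])

lemma closed_period_lattice:
  assumes "Im z > 0"
  shows "closed (period_lattice z)"
  using period_lattice_norm_less_imp_0[OF period_lattice_diff] assms
  by (intro discrete_imp_closed[of "min 1 (Im z)"]) (auto simp: dist_norm)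

lemma half_periods_notin_period_lattice:
  assumes "Im z > 0"
  shows "1/2 \<notin> period_lattice z" "z/2 \<notin> period_lattice z" "(1+z)/2 \<notin> period_lattice z"
proof -
  have half: "2 * of_int n \<noteq> (1 :: real)" for n :: int
  proof
    assume "2 * of_int n = (1 :: real)"
    then have "of_int (2 * n) = (of_int 1 :: real)"
      by simp
    then have "2 * n = 1"
      by (subst (asm) of_int_eq_iff)
    then show False
      by presburger
  qed
  have Im_half: "Im l \<noteq> Im z / 2" if "l \<in> period_lattice z" for l
    using that half assms by (auto simp: period_lattice_def field_simps)
  show "1/2 \<notin> period_lattice z"
  proof
    assume "1/2 \<in> period_lattice z"
    then obtain m n :: int where mn: "1/2 = of_int m + of_int n * z"
      by (auto simp: period_lattice_def)
    have "Im (1/2) = Im (of_int m + of_int n * z)" "Re (1/2) = Re (of_int m + of_int n * z)"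
      by (simp_all only: mn)
    with assms half[of m] show False
      by simp
  qed
  show "z/2 \<notin> period_lattice z" "(1+z)/2 \<notin> period_lattice z"
    using Im_half[of "z/2"] Im_half[of "(1+z)/2"] by auto
qed

text \<open>By periodicity the limit at 0 makes every lattice point a removable singularity. The
  extension \<open>g\<close> is entire and takes all its values on a compact parallelogram, so
  Liouville's theorem applies.\<close>

lemma doubly_periodic_eq_limit:
  fixes f :: "complex \<Rightarrow> complex"
  assumes z: "Im z > 0"
    and per: "\<And>w. f (w + 1) = f w" "\<And>w. f (w + z) = f w"
    and hol: "f holomorphic_on - period_lattice z"
    and lim: "(f \<longlongrightarrow> c) (at 0)"
    and w: "w \<notin> period_lattice z"
  shows "f w = c"
proof -
  define g where "g w = (if w \<in> period_lattice z then c else f w)" for w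
  have fn: "f (w + of_int n) = f w" for w and n :: int
  proof (induction n rule: int_induct[where k = 0])
    case (step1 i) then show ?case using per(1)[of "w + of_int i"] by (simp add: add_ac)
  next
    case (step2 i) then show ?case using per(1)[of "w + of_int i - 1"] by (simp add: algebra_simps)
  qed auto
  have fnz: "f (w + of_int n * z) = f w" for w and n :: int
  proof (induction n rule: int_induct[where k = 0])
    case (step1 i) then show ?case using per(2)[of "w + of_int i * z"] by (simp add: algebra_simps)
  next
    case (step2 i) then show ?case using per(2)[of "w + of_int i * z - z"] by (simp add: algebra_simps)
  qed auto
  have fl: "f (w + l) = f w" if "l \<in> period_lattice z" for w l
    using that fn fnz unfolding period_lattice_def by (auto simp: add.assoc[symmetric])
  have gl: "g (w + l) = g w" if "l \<in> period_lattice z" for w l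
  proof -
    have "w + l \<in> period_lattice z \<longleftrightarrow> w \<in> period_lattice z"
      using that period_lattice_diff[of "w + l" z l] period_lattice_diff[of w z "0 - l"] period_lattice_diff[of 0 z l]
      by auto
    with fl[OF that] show ?thesis
      by (simp add: g_def)
  qed
  define \<delta> where "\<delta> = min 1 (Im z)"
  have "\<delta> > 0"
    using z by (simp add: \<delta>_def)
  have \<delta>: "w \<notin> period_lattice z" if "w \<in> ball 0 \<delta> - {0}" for w
    using period_lattice_norm_less_imp_0[of w z] that by (auto simp: \<delta>_def)
  have "(\<lambda>y. if y = 0 then c else f y) holomorphic_on ball 0 \<delta>"
    using \<delta> by (intro removable_singularity lim holomorphic_on_subset[OF hol]) auto
  then have g0: "g holomorphic_on ball 0 \<delta>"
    by (rule holomorphic_transform) (use \<delta> in \<open>auto simp: g_def\<close>)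
  have "g field_differentiable (at w)" for w
  proof (cases "w \<in> period_lattice z")
    case True
    \<comment> \<open>Around a lattice point w, the function is a translate of its behaviour around
      0.\<close>
    have "(\<lambda>u. g (u - w)) holomorphic_on ball w \<delta>"
      by (rule holomorphic_on_compose_gen[OF _ g0, unfolded o_def])
         (auto intro!: holomorphic_intros simp: dist_norm norm_minus_commute)
    moreover have "g (u - w) = g u" for u
      using gl[OF True, of "u - w"] by simp
    ultimately have "g holomorphic_on ball w \<delta>"
      by simp
    then show ?thesis
      using \<open>\<delta> > 0\<close> holomorphic_on_imp_differentiable_at by (metis centre_in_ball open_ball)
  next
    case False
    have "g holomorphic_on - period_lattice z"
      by (rule holomorphic_transform[OF hol]) (auto simp: g_def)
    then show ?thesis
      using False closed_period_lattice[OF z] holomorphic_on_imp_differentiable_at[of g "- period_lattice z" w]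
      by (simp add: open_Compl)
  qed
  then have g: "g holomorphic_on UNIV"
    by (simp add: holomorphic_on_def)
  \<comment> \<open>The closed fundamental parallelogram; subtracting the integer parts of the real
    coordinates s, t of a point with respect to 1, z moves it there.\<close>
  define K where "K = (\<lambda>(s, t). of_real s + of_real t * z) ` ({0..1::real} \<times> {0..1::real})"
  have "compact K"
    unfolding K_def
    by (intro compact_continuous_image compact_Times compact_Icc)
       (auto simp: case_prod_unfold intro!: continuous_intros)
  then have "compact (g ` K)"
    using g by (meson compact_continuous_image continuous_on_subset holomorphic_on_imp_continuous_on subset_UNIV)
  moreover have "g w \<in> g ` K" for w
  proof -
    define t where "t = Im w / Im z"
    define s where "s = Re w - t * Re z"
    have weq: "w = of_real s + of_real t * z"
      using z by (simp add: complex_eq_iff s_def t_def)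
    define l where "l = of_int \<lfloor>s\<rfloor> + of_int \<lfloor>t\<rfloor> * z"
    have "l \<in> period_lattice z"
      by (auto simp: l_def period_lattice_def)
    moreover have "w - l \<in> K"
      unfolding K_def using less_imp_le[OF frac_lt_1]
      by (intro image_eqI[of _ _ "(frac s, frac t)"]) (auto simp: weq l_def, simp add: frac_def algebra_simps)
    ultimately show ?thesis
      using gl[of l "w - l"] by (metis diff_add_cancel imageI)
  qed
  ultimately have "bounded (range g)"
    by (meson bounded_subset compact_imp_bounded image_subsetI)
  then have "g w = g 0"
    using Liouville_theorem[OF g] unfolding constant_on_def by (metis UNIV_I)
  with w show ?thesis
    by (simp add: g_def)
qed

section \<open>Exponentials with periods 2 and 1\<close>

definition expi :: "complex \<Rightarrow> complex" where
  "expi t = exp (of_real pi * \<i> * t)"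

text \<open>The parameter q = exp(2 \<pi> i z) of modular forms; the classical nome exp(\<pi> i z)
  is its square root \<open>expi z\<close>, which enters through the half periods.\<close>

definition nome :: "complex \<Rightarrow> complex" where
  "nome z = expi (2 * z)"

lemma expi_add: "expi (s + t) = expi s * expi t"
  by (simp add: expi_def exp_add ring_distribs)

lemma expi_minus: "expi (- t) = inverse (expi t)"
  by (simp add: expi_def exp_minus)

lemma expi_diff: "expi (s - t) = expi s / expi t"
  by (simp add: expi_def exp_diff ring_distribs)

lemma expi_power: "expi t ^ n = expi (of_nat n * t)"
  by (simp add: expi_def exp_of_nat_mult[symmetric] mult_ac)

lemma expi_nonzero [simp]: "expi t \<noteq> 0"
  by (simp add: expi_def)

lemma expi_0 [simp]: "expi 0 = 1"
  and expi_1 [simp]: "expi 1 = -1"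
  by (simp_all add: expi_def)

lemma expi_2 [simp]: "expi 2 = 1"
  using expi_add[of 1 1] by simp

lemma nome_nonzero [simp]: "nome z \<noteq> 0"
  by (simp add: nome_def)

lemma nome_add: "nome (w + z) = nome w * nome z"
  by (simp add: nome_def expi_add ring_distribs)

lemma nome_minus: "nome (- z) = inverse (nome z)"
  using expi_minus[of "2 * z"] by (simp add: nome_def)

lemma nome_0 [simp]: "nome 0 = 1"
  by (simp add: nome_def)

lemma nome_eq_1_iff: "nome w = 1 \<longleftrightarrow> (\<exists>n::int. w = of_int n)"
proof -
  have "nome w = 1 \<longleftrightarrow> (\<exists>n::int. Im w = 0 \<and> Re w = of_int n)"
    by (auto simp: nome_def expi_def exp_eq_1)
  also have "\<dots> \<longleftrightarrow> (\<exists>n::int. w = of_int n)"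
    by (auto simp: complex_eq_iff)
  finally show ?thesis .
qed

lemma nome_of_int [simp]: "nome (of_int n) = 1"
  unfolding nome_eq_1_iff by blast

lemma nome_1 [simp]: "nome 1 = 1"
  using nome_of_int[of 1] by simp

lemma nome_power: "nome z ^ n = nome (of_nat n * z)"
  by (simp add: nome_def expi_power mult_ac)

lemma norm_nome: "norm (nome z) = exp (- (2 * pi * Im z))"
  by (simp add: nome_def expi_def)

lemma norm_nome_less_1: "Im z > 0 \<Longrightarrow> norm (nome z) < 1"
  by (simp add: norm_nome)

lemma holomorphic_expi [holomorphic_intros]:
  "f holomorphic_on A \<Longrightarrow> (\<lambda>w. expi (f w)) holomorphic_on A"
  unfolding expi_def by (intro holomorphic_intros)

lemma holomorphic_nome [holomorphic_intros]:
  "f holomorphic_on A \<Longrightarrow> (\<lambda>w. nome (f w)) holomorphic_on A"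
  unfolding nome_def by (intro holomorphic_intros)

lemma tendsto_expi [tendsto_intros]: "(f \<longlongrightarrow> c) F \<Longrightarrow> ((\<lambda>w. expi (f w)) \<longlongrightarrow> expi c) F"
  unfolding expi_def by (intro tendsto_intros)

lemma tendsto_nome [tendsto_intros]: "(f \<longlongrightarrow> c) F \<Longrightarrow> ((\<lambda>w. nome (f w)) \<longlongrightarrow> nome c) F"
  unfolding nome_def by (intro tendsto_intros)

section \<open>The product side of the theta function and the modularity of the discriminant\<close>

text \<open>The first symbol contains the factor 1 - x for x = \<open>nome w\<close>. By the Jacobi
  triple product this is a theta function up to factors without zeros.\<close>

definition theta_prod :: "complex \<Rightarrow> complex \<Rightarrow> complex" where
  "theta_prod z w = qpoch (nome z) (nome w) * qpoch (nome z) (nome z / nome w)"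

lemma theta_prod_plus_1: "theta_prod z (w + 1) = theta_prod z w"
  by (simp add: theta_prod_def nome_add)

text \<open>Replacing x by q x removes 1 - x from the first symbol and adds 1 - 1/x to the second,
  and (1 - 1/x) / (1 - x) = -1/x.\<close>

lemma theta_prod_plus_period:
  assumes "Im z > 0"
  shows "theta_prod z (w + z) = - nome (- w) * theta_prod z w"
proof -
  define q x where "q = nome z" and "x = nome w"
  have nz: "q \<noteq> 0" "x \<noteq> 0" and q: "norm q < 1"
    using norm_nome_less_1[OF assms] by (auto simp: q_def x_def)
  have "qpoch q (1 / x) = (1 - 1 / x) * qpoch q (q / x)"
    using qpoch_rec[OF q, of "1 / x"] by simp
  moreover have "qpoch q x = (1 - x) * qpoch q (x * q)"
    by (rule qpoch_rec[OF q])
  moreover have "1 - 1 / x = - inverse x * (1 - x)"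
    using nz by (simp add: field_simps)
  ultimately have "qpoch q (x * q) * qpoch q (1 / x) = - inverse x * (qpoch q x * qpoch q (q / x))"
    by simp
  then show ?thesis
    using nz by (simp add: theta_prod_def nome_add nome_minus q_def x_def)
qed

lemma theta_prod_minus_period:
  assumes "Im z > 0"
  shows "theta_prod z (w - z) = - nome (w - z) * theta_prod z w"
  using theta_prod_plus_period[OF assms, of "w - z"]
  by (simp add: nome_minus[of "w - z", simplified])

text \<open>A vanishing factor would make w + k z or w - (k + 1) z an integer for some k \<ge>
  0.\<close>

lemma theta_prod_nonzero:
  assumes z: "Im z > 0" and w: "w \<notin> period_lattice z"
  shows "theta_prod z w \<noteq> 0"
proof -
  have notint: "w + of_int n * z \<noteq> of_int m" for m n
  proof
    assume "w + of_int n * z = of_int m"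
    then have "w = of_int m + of_int (- n) * z"
      by (simp add: algebra_simps)
    with w show False
      unfolding period_lattice_def by blast
  qed
  have "nome w * nome z ^ k \<noteq> 1" for k
  proof -
    have "nome w * nome z ^ k = nome (w + of_int (int k) * z)"
      by (simp add: nome_add nome_power)
    then show ?thesis
      using notint[of "int k"] by (auto simp: nome_eq_1_iff)
  qed
  moreover have "nome z / nome w * nome z ^ k \<noteq> 1" for k
  proof -
    have "nome z / nome w * nome z ^ k = inverse (nome (w + of_int (- int (Suc k)) * z))"
    proof -
      have "- (w + of_int (- int (Suc k)) * z) = z + - w + of_nat k * z"
        by (simp add: algebra_simps)
      then show ?thesis
        unfolding nome_minus[symmetric] by (simp only: nome_add nome_power nome_minus divide_inverse)
    qed
    then show ?thesis
      using notint[of "- int (Suc k)"]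
      by (auto simp only: inverse_eq_1_iff nome_eq_1_iff)
  qed
  ultimately show ?thesis
    using qpoch_nonzero[OF norm_nome_less_1[OF z]] by (simp add: theta_prod_def)
qed

text \<open>The exponent is the one for which the factors of automorphy of both theta products cancel.\<close>
definition theta_gauge :: "complex \<Rightarrow> complex \<Rightarrow> complex" where
  "theta_gauge z w = expi (- (w\<^sup>2) / z + (1 - 1 / z) * w)"

text \<open>Division by z carries the lattice of z onto that of -1/z, so the zeros of numerator and
  denominator can cancel.\<close>

definition theta_quot :: "complex \<Rightarrow> complex \<Rightarrow> complex" where
  "theta_quot z w = theta_gauge z w * theta_prod (-1 / z) (w / z) / theta_prod z w"

lemma Im_minus_inverse: "Im (-1 / z) = Im z / (norm z)\<^sup>2"
  by (simp add: Im_divide cmod_power2)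

lemma Im_minus_inverse_pos: "Im z > 0 \<Longrightarrow> Im (-1 / z) > 0"
  unfolding Im_minus_inverse by (auto intro!: divide_pos_pos)

text \<open>Here w/z moves by 1/z, a negative period of the lattice for -1/z, so only the numerator
  acquires a factor. Together with the change of the gauge it contributes the exponent 2, a period
  of \<open>expi\<close>.\<close>

lemma theta_quot_plus_1:
  assumes z: "Im z > 0"
  shows "theta_quot z (w + 1) = theta_quot z w"
proof -
  have nz: "z \<noteq> 0"
    using z by auto
  have "theta_prod (-1 / z) ((w + 1) / z) = theta_prod (-1 / z) (w / z - (-1 / z))"
    by (simp add: add_divide_distrib)
  also have "\<dots> = expi 1 * nome ((w + 1) / z) * theta_prod (-1 / z) (w / z)"
    using theta_prod_minus_period[OF Im_minus_inverse_pos[OF z], of "w / z"]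
    by (simp add: add_divide_distrib)
  finally have 1: "theta_prod (-1 / z) ((w + 1) / z) = expi 1 * nome ((w + 1) / z) * theta_prod (-1 / z) (w / z)" .
  have "theta_gauge z (w + 1) * (expi 1 * nome ((w + 1) / z)) =
      expi ((- ((w + 1)\<^sup>2) / z + (1 - 1 / z) * (w + 1)) + (1 + 2 * ((w + 1) / z)))"
    by (simp add: theta_gauge_def nome_def expi_add del: expi_1)
  also have "(- ((w + 1)\<^sup>2) / z + (1 - 1 / z) * (w + 1)) + (1 + 2 * ((w + 1) / z)) =
      (- (w\<^sup>2) / z + (1 - 1 / z) * w) + 2"
    using nz by (simp add: field_simps power2_eq_square)
  also have "expi \<dots> = theta_gauge z w"
    by (simp only: theta_gauge_def expi_add expi_2 mult_1_right)
  finally show ?thesis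
    unfolding theta_quot_def theta_prod_plus_1 1 by (metis mult.assoc)
qed

text \<open>Here w/z moves by 1, so the numerator product is unchanged and the gauge compensates the
  factor of the denominator.\<close>

lemma theta_quot_plus_period:
  assumes z: "Im z > 0"
  shows "theta_quot z (w + z) = theta_quot z w"
proof -
  have nz: "z \<noteq> 0"
    using z by auto
  have 1: "theta_prod (-1 / z) ((w + z) / z) = theta_prod (-1 / z) (w / z)"
    using theta_prod_plus_1[of "-1 / z" "w / z"] nz by (simp add: add_divide_distrib)
  have "theta_gauge z (w + z) = expi ((- (w\<^sup>2) / z + (1 - 1 / z) * w) + (- 1 + 2 * (- w)))"
    unfolding theta_gauge_def
    by (rule arg_cong[where f = expi]) (use nz in \<open>simp add: field_simps power2_eq_square\<close>)
  also have "\<dots> = theta_gauge z w * (- nome (- w))"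
    by (simp only: theta_gauge_def expi_add expi_minus nome_def expi_1) simp
  finally show ?thesis
    unfolding theta_quot_def 1 theta_prod_plus_period[OF z] by simp
qed

text \<open>The limit is the quotient of the derivatives at 0 of \<open>nome (w / z)\<close> and
  \<open>nome w\<close>.\<close>

lemma tendsto_nome_quotient:
  assumes "z \<noteq> 0"
  shows "((\<lambda>w. (1 - nome (w / z)) / (1 - nome w)) \<longlongrightarrow> 1 / z) (at 0)"
proof -
  have "((\<lambda>w. nome (w / c)) has_field_derivative (of_real pi * \<i> * (2 / c))) (at 0)" if "c \<noteq> 0" for c
    using that unfolding nome_def expi_def by (auto intro!: derivative_eq_intros)
  then have 1: "((\<lambda>w. (nome (w / c) - 1) / w) \<longlongrightarrow> of_real pi * \<i> * (2 / c)) (at 0)" if "c \<noteq> 0" for c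
    using that by (simp add: has_field_derivative_iff)
  have "((\<lambda>w. ((nome (w / z) - 1) / w) / ((nome (w / 1) - 1) / w)) \<longlongrightarrow>
      (of_real pi * \<i> * (2 / z)) / (of_real pi * \<i> * (2 / 1))) (at 0)"
    by (intro tendsto_divide 1) (use assms in auto)
  then have "((\<lambda>w. ((nome (w / z) - 1) / w) / ((nome w - 1) / w)) \<longlongrightarrow> 1 / z) (at 0)"
    by simp
  then show ?thesis
  proof (rule filterlim_cong[THEN iffD1, OF refl refl, rotated])
    show "\<forall>\<^sub>F w in at 0. (nome (w / z) - 1) / w / ((nome w - 1) / w) = (1 - nome (w / z)) / (1 - nome w)"
      using minus_divide_divide[of "nome (w / z) - 1" "nome w - 1" for w]
      by (simp add: eventually_at_filter)
  qed
qed

lemma theta_quot_eq: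
  assumes z: "Im z > 0" and w: "w \<notin> period_lattice z"
  defines "q \<equiv> nome z" and "q' \<equiv> nome (-1 / z)"
  shows "theta_quot z w = (qpoch q' q')\<^sup>2 / (z * (qpoch q q)\<^sup>2)"
proof (rule doubly_periodic_eq_limit[OF z _ _ _ _ w])
  have nz: "z \<noteq> 0"
    using z by auto
  have q: "norm q < 1" "norm q' < 1"
    unfolding q_def q'_def by (intro norm_nome_less_1 z Im_minus_inverse_pos)+
  show "theta_quot z (w + 1) = theta_quot z w" "theta_quot z (w + z) = theta_quot z w" for w
    using theta_quot_plus_1[OF z] theta_quot_plus_period[OF z] by simp_all
  show "theta_quot z holomorphic_on - period_lattice z"
    unfolding theta_quot_def[abs_def] theta_gauge_def theta_prod_def
    using theta_prod_nonzero[OF z] q nz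
    by (intro holomorphic_intros) (auto simp: theta_prod_def q_def q'_def)
  \<comment> \<open>The theta product without its factor 1 - \<open>nome w\<close>, the one that
    vanishes at w = 0.\<close>
  define F where "F = (\<lambda>u w. qpoch (nome u) (nome w * nome u) * qpoch (nome u) (nome u / nome w))"
  have F: "theta_prod u w = (1 - nome w) * F u w" if "norm (nome u) < 1" for u w
    using qpoch_rec[OF that, of "nome w"] by (simp add: theta_prod_def F_def)
  have Flim: "((\<lambda>w. F u (w / c)) \<longlongrightarrow> (qpoch (nome u) (nome u))\<^sup>2) (at 0)"
    if "norm (nome u) < 1" for u c
  proof -
    have "((\<lambda>w. w / c) \<longlongrightarrow> 0) (at 0)"
      by (auto intro!: tendsto_eq_intros simp: divide_inverse)
    then have "((\<lambda>w. F u (w / c)) \<longlongrightarrow> qpoch (nome u) (nome 0 * nome u) * qpoch (nome u) (nome u / nome 0)) (at 0)"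
      unfolding F_def by (intro tendsto_intros that) auto
    then show ?thesis
      by (simp add: power2_eq_square)
  qed
  \<comment> \<open>The vanishing factors are collected in one quotient with limit 1/z. Writing
    \<open>w / 1\<close> lets \<open>Flim\<close> serve numerator and denominator alike.\<close>
  have "((\<lambda>w. theta_gauge z w * ((1 - nome (w / z)) / (1 - nome w)) * (F (-1 / z) (w / z) / F z (w / 1)))
      \<longlongrightarrow> theta_gauge z 0 * (1 / z) * ((qpoch q' q')\<^sup>2 / (qpoch q q)\<^sup>2)) (at 0)"
    unfolding theta_gauge_def q_def q'_def
    by (intro tendsto_intros tendsto_nome_quotient nz Flim)
       (use q qpoch_nonzero'[OF q(1) q(1)] nz in \<open>simp_all add: q_def q'_def\<close>)
  then show "(theta_quot z \<longlongrightarrow> (qpoch q' q')\<^sup>2 / (z * (qpoch q q)\<^sup>2)) (at 0)"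
    using q by (simp add: theta_quot_def[abs_def] F q_def q'_def theta_gauge_def mult_ac)
qed

text \<open>With q = r^2, the half periods give x = -1, r, -r. For the last two, x = q/x and both
  symbols agree; for x = -1 they agree after splitting off the factor 1 - x = 2.\<close>

lemma theta_prod_half_periods:
  assumes z: "Im z > 0"
  defines "r \<equiv> expi z"
  shows "theta_prod z (1/2) = 2 * (qpoch (r\<^sup>2) (- (r\<^sup>2)))\<^sup>2"
    and "theta_prod z (z/2) = (qpoch (r\<^sup>2) r)\<^sup>2"
    and "theta_prod z ((1+z)/2) = (qpoch (r\<^sup>2) (- r))\<^sup>2"
proof -
  have q: "nome z = r\<^sup>2"
    by (simp add: nome_def r_def expi_power)
  have "norm (r\<^sup>2) < 1"
    using norm_nome_less_1[OF z] by (simp add: q)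
  then have "qpoch (r\<^sup>2) (- 1) = 2 * qpoch (r\<^sup>2) (- (r\<^sup>2))"
    using qpoch_rec[of "r\<^sup>2" "-1"] by simp
  moreover have "r \<noteq> 0"
    by (simp add: r_def)
  moreover have "nome (1/2) = -1" "nome (z/2) = r"
    by (simp_all add: nome_def r_def)
  moreover have "nome ((1+z)/2) = - r"
    unfolding add_divide_distrib nome_add by (simp add: calculation)
  ultimately show "theta_prod z (1/2) = 2 * (qpoch (r\<^sup>2) (- (r\<^sup>2)))\<^sup>2"
    "theta_prod z (z/2) = (qpoch (r\<^sup>2) r)\<^sup>2" "theta_prod z ((1+z)/2) = (qpoch (r\<^sup>2) (- r))\<^sup>2"
    by (simp_all add: theta_prod_def q power2_eq_square)
qed

text \<open>The modular discriminant, the 24th power of the Dedekind eta function, normalised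
  without the factor (2 \<pi>)^12.\<close>

definition cusp_disc :: "complex \<Rightarrow> complex" where
  "cusp_disc z = nome z * qpoch (nome z) (nome z) ^ 24"

theorem cusp_disc_minus_inverse:
  assumes z: "Im z > 0"
  shows "cusp_disc (-1 / z) = z ^ 12 * cusp_disc z"
proof -
  define z' where "z' = -1 / z"
  have nz: "z \<noteq> 0"
    using z by auto
  have z': "Im z' > 0"
    unfolding z'_def by (rule Im_minus_inverse_pos[OF z])
  define r r' where "r = expi z" and "r' = expi z'"
  have qr: "nome z = r\<^sup>2" "nome z' = r'\<^sup>2"
    by (simp_all add: nome_def r_def r'_def expi_power)
  define g g' where "g = qpoch (nome z) (nome z)" and "g' = qpoch (nome z') (nome z')"
  define C where "C = g'\<^sup>2 / (z * g\<^sup>2)"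
  have g: "g \<noteq> 0"
    using qpoch_nonzero' norm_nome_less_1[OF z] by (simp add: g_def)
  have E: "theta_gauge z w * theta_prod z' (w / z) = C * theta_prod z w" if "w \<notin> period_lattice z" for w
    using theta_quot_eq[OF z that] theta_prod_nonzero[OF z that]
    by (simp add: theta_quot_def C_def g_def g'_def z'_def field_simps)
  define A B D where "A = qpoch (r\<^sup>2) r" and "B = qpoch (r\<^sup>2) (- (r\<^sup>2))" and "D = qpoch (r\<^sup>2) (- r)"
  define A' B' D' where "A' = qpoch (r'\<^sup>2) r'" and "B' = qpoch (r'\<^sup>2) (- (r'\<^sup>2))" and "D' = qpoch (r'\<^sup>2) (- r')"
  have "norm r < 1" "norm r' < 1"
    using z z' by (simp_all add: r_def r'_def expi_def)
  then have 1: "B * (A * D) = 1" "B' * (A' * D') = 1"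
    unfolding A_def B_def D_def A'_def B'_def D'_def by (auto intro: qpoch_triple_product_one)
  \<comment> \<open>Division by z maps half periods for z to half periods for z', up to the period
    z'; the first two kinds are exchanged.\<close>
  have half: "1/2/z = z'/2 - z'" "z/2/z = 1/2" "(1+z)/2/z = (1+z')/2 - z'"
    using nz by (simp_all add: z'_def field_simps)
  have "theta_gauge z (1/2) * (- nome (z'/2 - z') * A'\<^sup>2) = C * (2 * B\<^sup>2)"
    using E[OF half_periods_notin_period_lattice(1)[OF z]]
    unfolding half theta_prod_minus_period[OF z'] A'_def B_def r_def r'_def
      theta_prod_half_periods[OF z] theta_prod_half_periods[OF z'] .
  moreover have "theta_gauge z (z/2) * (2 * B'\<^sup>2) = C * A\<^sup>2"
    using E[OF half_periods_notin_period_lattice(2)[OF z]]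
    unfolding half theta_prod_minus_period[OF z'] A_def B'_def r_def r'_def
      theta_prod_half_periods[OF z] theta_prod_half_periods[OF z'] .
  moreover have "theta_gauge z ((1+z)/2) * (- nome ((1+z')/2 - z') * D'\<^sup>2) = C * D\<^sup>2"
    using E[OF half_periods_notin_period_lattice(3)[OF z]]
    unfolding half theta_prod_minus_period[OF z'] D_def D'_def r_def r'_def
      theta_prod_half_periods[OF z] theta_prod_half_periods[OF z'] .
  \<comment> \<open>In the product of the three relations the unknown values occur only through
    \<open>B * (A * D)\<close> and \<open>B' * (A' * D')\<close>, both equal to 1.\<close>
  ultimately have "(theta_gauge z (1/2) * (- nome (z'/2 - z') * A'\<^sup>2)) *
      (theta_gauge z (z/2) * (2 * B'\<^sup>2)) * (theta_gauge z ((1+z)/2) * (- nome ((1+z')/2 - z') * D'\<^sup>2)) =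
      C * (2 * B\<^sup>2) * (C * A\<^sup>2) * (C * D\<^sup>2)"
    by simp
  then have "theta_gauge z (1/2) * theta_gauge z (z/2) * theta_gauge z ((1+z)/2) *
      (nome (z'/2 - z') * nome ((1+z')/2 - z')) * (B' * (A' * D'))\<^sup>2 = C ^ 3 * (B * (A * D))\<^sup>2"
    by (simp add: power2_eq_square power3_eq_cube mult_ac)
  then have C3: "C ^ 3 = theta_gauge z (1/2) * theta_gauge z (z/2) * theta_gauge z ((1+z)/2) *
      (nome (z'/2 - z') * nome ((1+z')/2 - z'))"
    using 1 by simp
  define s where "s = (- ((1/2)\<^sup>2) / z + (1 - 1 / z) * (1/2)) + (- ((z/2)\<^sup>2) / z + (1 - 1 / z) * (z/2))
    + (- (((1+z)/2)\<^sup>2) / z + (1 - 1 / z) * ((1+z)/2)) + (2 * (z'/2 - z') + 2 * ((1+z')/2 - z'))"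
  have "C ^ 3 = expi s"
    unfolding C3 theta_gauge_def nome_def s_def by (simp only: expi_add)
  \<comment> \<open>The fourth power yields C^12, which contains exactly the 24th powers and z^12 of
    the claim; no cube root has to be chosen.\<close>
  then have "(C ^ 3) ^ 4 = expi s ^ 4"
    by simp
  then have "C ^ 12 = expi s ^ 4"
    by (simp flip: power_mult)
  also have "\<dots> = expi (4 * s)"
    by (simp add: expi_power)
  also have "4 * s = 2 * z - 2 * z' + 2"
    using nz by (simp add: s_def z'_def field_simps power2_eq_square)
  also have "expi \<dots> = nome z / nome z'"
    by (simp add: expi_add expi_diff nome_def)
  finally have "g' ^ 24 / (z ^ 12 * g ^ 24) = nome z / nome z'"
    by (simp add: C_def power_divide power_mult_distrib flip: power_mult)
  then show ?thesis
    using nz g by (simp add: cusp_disc_def g_def g'_def z'_def[symmetric] field_simps del: minus_divide_left divide_minus_left)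
qed

section \<open>Transformation under the full modular group\<close>

lemma cusp_disc_plus_int: "cusp_disc (z + of_int n) = cusp_disc z"
  by (simp add: cusp_disc_def nome_add)

lemma Im_moebius:
  fixes a b c d :: int
  assumes "a * d - b * c = 1"
  shows "Im ((of_int a * z + of_int b) / (of_int c * z + of_int d)) = Im z / (norm (of_int c * z + of_int d))\<^sup>2"
proof -
  have "of_int a * Im z * (of_int c * Re z + of_int d) - (of_int a * Re z + of_int b) * (of_int c * Im z) =
      of_int (a * d - b * c) * Im z"
    by (simp add: algebra_simps)
  then show ?thesis
    using assms by (simp add: Im_divide cmod_power2)
qed

lemma int_linear_nonzero:
  fixes c d :: int
  assumes "Im z > 0" "c \<noteq> 0 \<or> d \<noteq> 0"
  shows "of_int c * z + of_int d \<noteq> 0"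
proof
  assume 0: "of_int c * z + of_int d = 0"
  then have "Im (of_int c * z + of_int d) = 0"
    by (simp only: zero_complex.simps)
  then have "c = 0"
    using assms by simp
  with 0 assms show False
    by simp
qed

text \<open>Euclid's algorithm on the first column (a, c): a translation by k = a div c reduces a to
  a mod c, and an inversion then makes this remainder the new lower left entry, of smaller
  modulus.\<close>

theorem cusp_disc_moebius:
  fixes a b c d :: int
  assumes "a * d - b * c = 1" and z: "Im z > 0"
  shows "cusp_disc ((of_int a * z + of_int b) / (of_int c * z + of_int d)) =
    (of_int c * z + of_int d) ^ 12 * cusp_disc z"
  using assms(1)
proof (induction "nat \<bar>c\<bar>" arbitrary: a b c d rule: less_induct)
  case less
  show ?case
  proof (cases "c = 0")
    case True
    with less.prems have "a = 1 \<and> d = 1 \<or> a = -1 \<and> d = -1"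
      by (simp add: zmult_eq_1_iff)
    then show ?thesis
      using True cusp_disc_plus_int[of z b] cusp_disc_plus_int[of z "- b"] by auto
  next
    case False
    define k a' b' where "k = a div c" and "a' = a mod c" and "b' = b - k * d"
    have a': "a' = a - k * c"
      by (simp add: a'_def k_def minus_div_mult_eq_mod)
    have det: "a' * d - b' * c = 1"
      using less.prems by (simp add: a' b'_def algebra_simps)
    define N D where "N = of_int a' * z + of_int b'" and "D = of_int c * z + of_int d"
    have nz: "N \<noteq> 0" "D \<noteq> 0"
      unfolding N_def D_def using det by (intro int_linear_nonzero z; force)+
    have "Im (N / D) > 0"
      using Im_moebius[OF det, of z] z nz(2) by (simp add: N_def D_def)
    then have "cusp_disc (-1 / (N / D)) = (N / D) ^ 12 * cusp_disc (N / D)"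
      by (rule cusp_disc_minus_inverse)
    moreover have "cusp_disc ((of_int (- c) * z + of_int (- d)) / (of_int a' * z + of_int b')) =
        (of_int a' * z + of_int b') ^ 12 * cusp_disc z"
    proof (rule less.hyps)
      show "nat \<bar>a'\<bar> < nat \<bar>c\<bar>"
        using False by (simp add: a'_def abs_mod_less)
      show "- c * b' - - d * a' = 1"
        using det by (simp add: algebra_simps)
    qed
    then have "cusp_disc (-1 / (N / D)) = N ^ 12 * cusp_disc z"
      using nz by (simp add: N_def D_def minus_divide_left add.commute)
    ultimately have "cusp_disc (N / D) = D ^ 12 * cusp_disc z"
      using nz by (simp add: power_divide divide_eq_eq mult_ac)
    moreover have "(of_int a * z + of_int b) / D = N / D + of_int k"
      using nz by (simp add: N_def a' b'_def) (simp add: D_def field_simps)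
    ultimately show ?thesis
      by (simp add: D_def cusp_disc_plus_int)
  qed
qed

section \<open>Hecke operators\<close>

text \<open>The operator T_p in weight 12 applied to the discriminant, scaled so that it preserves
  integrality of the coefficients.\<close>

definition hecke :: "nat \<Rightarrow> complex \<Rightarrow> complex" where
  "hecke p z = of_nat p ^ 11 * cusp_disc (of_nat p * z) + (\<Sum>b<p. cusp_disc ((z + of_nat b) / of_nat p)) / of_nat p"

text \<open>The involution b -> -1/b on the nonzero residues modulo p, by which inversion permutes
  the terms of the Hecke sum.\<close>

lemma negative_inverse_mod_prime:
  assumes "prime p"
  obtains \<sigma> :: "nat \<Rightarrow> nat" where "\<And>b. b \<in> {1..<p} \<Longrightarrow> \<sigma> b \<in> {1..<p}"
    "\<And>b. b \<in> {1..<p} \<Longrightarrow> p dvd b * \<sigma> b + 1" "\<And>b. b \<in> {1..<p} \<Longrightarrow> \<sigma> (\<sigma> b) = b"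
proof -
  have ex: "\<exists>b'\<in>{1..<p}. p dvd b * b' + 1" if b: "b \<in> {1..<p}" for b
  proof -
    have "\<not> p dvd b"
      using b by (auto dest: dvd_imp_le)
    then have "coprime (int b) (int p)"
      using prime_imp_coprime[OF assms] by (simp add: coprime_commute)
    then obtain u v where uv: "u * int b + v * int p = 1"
      using bezout_int[of "int b" "int p"] by (auto simp: coprime_iff_gcd_eq_1)
    have "p > 0"
      using assms by (simp add: prime_gt_0_nat)
    \<comment> \<open>By the Bezout relation u inverts b modulo p, so -u has the required
      property.\<close>
    define b' where "b' = nat ((- u) mod int p)"
    have int_b': "int b' = (- u) mod int p"
      using \<open>p > 0\<close> by (simp add: b'_def)
    have "int (b * b' + 1) = (int b * (- u) + 1) - int p * (int b * ((- u) div int p))"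
      using minus_mult_div_eq_mod[of "- u" "int p"] by (simp add: int_b' algebra_simps flip: minus_mult_div_eq_mod)
    also have "int b * (- u) + 1 = int p * v"
      using uv by (simp add: algebra_simps)
    finally have "int p dvd int (b * b' + 1)"
      by simp
    then have dvd: "p dvd b * b' + 1"
      by (simp only: int_dvd_int_iff)
    moreover have "b' \<noteq> 0"
      using dvd prime_gt_1_nat[OF assms] by (cases b') auto
    moreover have "b' < p"
      using \<open>p > 0\<close> by (simp add: b'_def nat_less_iff)
    ultimately show ?thesis
      by auto
  qed
  have unique: "x = y" if "b \<in> {1..<p}" "x \<in> {1..<p}" "y \<in> {1..<p}" "p dvd b * x + 1" "p dvd b * y + 1" for b x y
  proof -
    have "int p dvd int (b * x + 1) - int (b * y + 1)"
      using that(4,5) by (intro dvd_diff) (simp_all only: int_dvd_int_iff)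
    then have "int p dvd int b * (int x - int y)"
      by (simp add: algebra_simps)
    moreover have "\<not> int p dvd int b"
      using that(1) by (auto dest: dvd_imp_le)
    ultimately have "int p dvd int x - int y"
      using assms by (simp add: prime_dvd_mult_iff)
    then show ?thesis
      using that(2,3) zdvd_imp_le[of "int p" "int x - int y"] zdvd_imp_le[of "int p" "int y - int x"]
      by (cases x y rule: linorder_cases) (auto simp: dvd_diff_commute)
  qed
  obtain \<sigma> where \<sigma>: "\<And>b. b \<in> {1..<p} \<Longrightarrow> \<sigma> b \<in> {1..<p} \<and> p dvd b * \<sigma> b + 1"
    using ex by metis
  show ?thesis
  proof (rule that[of \<sigma>])
    fix b assume b: "b \<in> {1..<p}"
    show "\<sigma> (\<sigma> b) = b"
      using unique[of "\<sigma> b" "\<sigma> (\<sigma> b)" b] \<sigma>[OF b] \<sigma>[of "\<sigma> b"] b by (simp add: mult.commute)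
  qed (use \<sigma> in auto)
qed

text \<open>With b b' + 1 = p m, the matrix with rows (b, -m) and (p, -b') has determinant 1. It
  maps w = (z + b')/p to (-1/z + b)/p, and its factor of automorphy p w - b' is z.\<close>

lemma cusp_disc_hecke_term:
  assumes p: "p > 0" and dvd: "p dvd b * b' + 1" and z: "Im z > 0"
  shows "cusp_disc ((-1 / z + of_nat b) / of_nat p) = z ^ 12 * cusp_disc ((z + of_nat b') / of_nat p)"
proof -
  obtain m where m: "b * b' + 1 = p * m"
    using dvd by blast
  have m': "int b * int b' + 1 = int p * int m" "of_nat b * of_nat b' + 1 = (of_nat p * of_nat m :: complex)"
    by (metis m of_nat_1 of_nat_add of_nat_mult)+
  define w where "w = (z + of_nat b') / of_nat p"
  have "Im w > 0"
    using z p by (simp add: w_def Im_divide_of_nat)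
  moreover have "int b * (- int b') - (- int m) * int p = 1"
    using m' by (simp add: algebra_simps)
  ultimately have "cusp_disc ((of_int (int b) * w + of_int (- int m)) / (of_int (int p) * w + of_int (- int b'))) =
      (of_int (int p) * w + of_int (- int b')) ^ 12 * cusp_disc w"
    by (intro cusp_disc_moebius)
  moreover have "of_int (int p) * w + of_int (- int b') = z"
    using p by (simp add: w_def)
  moreover have "(of_int (int b) * w + of_int (- int m)) / z = (-1 / z + of_nat b) / of_nat p"
  proof -
    have "of_int (int b) * w + of_int (- int m) = (of_nat b * z + (of_nat b * of_nat b' - of_nat p * of_nat m)) / of_nat p"
      using p by (simp add: w_def field_simps)
    also have "of_nat b * of_nat b' - of_nat p * of_nat m = (- 1 :: complex)"
      using m'(2) by (simp add: algebra_simps eq_diff_eq)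
    finally have 1: "of_int (int b) * w + of_int (- int m) = (of_nat b * z + - 1) / of_nat p" .
    show ?thesis
      unfolding 1 using z p by (cases "z = 0") (simp_all add: field_simps)
  qed
  ultimately show ?thesis
    by (simp add: w_def)
qed

text \<open>Inversion exchanges the term at p z with the term b = 0 and permutes the others by
  \<sigma>.\<close>

theorem hecke_minus_inverse:
  assumes p: "prime p" and z: "Im z > 0"
  shows "hecke p (-1 / z) = z ^ 12 * hecke p z"
proof -
  have p0: "p > 0" and nz: "z \<noteq> 0"
    using p z by (auto simp: prime_gt_0_nat)
  obtain \<sigma> where \<sigma>: "\<And>b. b \<in> {1..<p} \<Longrightarrow> \<sigma> b \<in> {1..<p}"
    "\<And>b. b \<in> {1..<p} \<Longrightarrow> p dvd b * \<sigma> b + 1" "\<And>b. b \<in> {1..<p} \<Longrightarrow> \<sigma> (\<sigma> b) = b"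
    using negative_inverse_mod_prime[OF p] by blast
  have split: "(\<Sum>b<p. f b) = f 0 + (\<Sum>b=1..<p. f b)" for f :: "nat \<Rightarrow> complex"
    using p0 by (simp add: lessThan_atLeast0 sum.atLeast_Suc_lessThan)
  have "cusp_disc (of_nat p * (-1 / z)) = cusp_disc (-1 / (z / of_nat p))"
    by (simp add: field_simps)
  also have "\<dots> = (z / of_nat p) ^ 12 * cusp_disc (z / of_nat p)"
    using z p0 by (intro cusp_disc_minus_inverse) (simp add: Im_divide_of_nat)
  finally have 1: "of_nat p ^ 11 * cusp_disc (of_nat p * (-1 / z)) = z ^ 12 * (cusp_disc (z / of_nat p) / of_nat p)"
    using p0 by (simp add: power_divide field_simps eval_nat_numeral)
  have "cusp_disc (-1 / z / of_nat p) = cusp_disc (-1 / (of_nat p * z))"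
    by (simp add: field_simps)
  also have "\<dots> = (of_nat p * z) ^ 12 * cusp_disc (of_nat p * z)"
    using z p0 by (intro cusp_disc_minus_inverse) simp
  finally have 2: "cusp_disc (-1 / z / of_nat p) / of_nat p = z ^ 12 * (of_nat p ^ 11 * cusp_disc (of_nat p * z))"
    using p0 by (simp add: power_mult_distrib field_simps eval_nat_numeral)
  have "(\<Sum>b=1..<p. cusp_disc ((-1 / z + of_nat b) / of_nat p)) =
      (\<Sum>b=1..<p. z ^ 12 * cusp_disc ((z + of_nat (\<sigma> b)) / of_nat p))"
    using \<sigma>(2) p0 z by (intro sum.cong refl cusp_disc_hecke_term) auto
  also have "\<dots> = (\<Sum>b=1..<p. z ^ 12 * cusp_disc ((z + of_nat b) / of_nat p))"
    by (rule sum.reindex_bij_witness[of _ \<sigma> \<sigma>]) (use \<sigma>(1,3) in auto)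
  finally have 3: "(\<Sum>b=1..<p. cusp_disc ((-1 / z + of_nat b) / of_nat p)) =
      z ^ 12 * (\<Sum>b=1..<p. cusp_disc ((z + of_nat b) / of_nat p))"
    by (simp add: sum_distrib_left)
  show ?thesis
    unfolding hecke_def split add_divide_distrib[of "cusp_disc _"] 1 3
    using 2 by (simp add: ring_distribs)
qed

section \<open>Power series in q of the discriminant and its Hecke image\<close>

lemma ramanujan_tau_power_series:
  assumes "norm (x::complex) < 1"
  shows "(\<lambda>k. of_int (ramanujan_tau k) * x ^ k) sums (x * qpoch x x ^ 24)"
proof -
  have "(\<Prod>k. (1 - x ^ Suc k) ^ 24) = qpoch x x ^ 24"
    using prodinf_power[OF convergent_prod_one_minus_power[OF assms], of 24] by (simp add: qpoch_def)
  then show ?thesis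
    using ramanujan_tau_sums[OF assms] sums_Suc_iff[of "\<lambda>k. of_int (ramanujan_tau k) * x ^ k"]
    by (simp add: ramanujan_tau_0)
qed

lemma cusp_disc_sums:
  assumes "Im z > 0"
  shows "(\<lambda>k. of_int (ramanujan_tau k) * nome z ^ k) sums cusp_disc z"
  using ramanujan_tau_power_series[OF norm_nome_less_1[OF assms]] by (simp add: cusp_disc_def)

lemma sums_multiples_iff:
  fixes f :: "nat \<Rightarrow> 'a::real_normed_vector"
  assumes "p > 0" "\<And>n. \<not> p dvd n \<Longrightarrow> f n = 0"
  shows "(\<lambda>n. f (p * n)) sums s \<longleftrightarrow> f sums s"
  using assms by (intro sums_mono_reindex) (auto simp: strict_mono_def dvd_def)

text \<open>A geometric sum over a p-th root of unity, which is 1 exactly when p divides n. It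
  filters out the coefficients whose index is a multiple of p.\<close>

lemma sum_nome_roots_of_unity:
  assumes "p > 0"
  shows "(\<Sum>b<p. nome (of_nat n / of_nat p) ^ b) = (if p dvd n then of_nat p else 0)"
proof (cases "p dvd n")
  case True
  then obtain m where "n = p * m"
    by blast
  then have "nome (of_nat n / of_nat p) = 1"
    using assms nome_of_int[of "int m"] by simp
  with True show ?thesis
    by simp
next
  case False
  have "nome (of_nat n / of_nat p) \<noteq> 1"
  proof
    assume "nome (of_nat n / of_nat p) = 1"
    then obtain k :: int where "of_nat n / of_nat p = (of_int k :: complex)"
      unfolding nome_eq_1_iff by blast
    then have "of_int (int n) = (of_int (k * int p) :: complex)"
      using assms by (simp add: field_simps)
    then have "int n = k * int p"
      by (subst (asm) of_int_eq_iff)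
    then have "int p dvd int n"
      by simp
    with False show False
      by simp
  qed
  moreover have "nome (of_nat n / of_nat p) ^ p = 1"
    using assms nome_of_int[of "int n"] by (simp add: nome_power)
  ultimately show ?thesis
    using False by (simp add: geometric_sum)
qed

definition hecke_coeff :: "nat \<Rightarrow> nat \<Rightarrow> int" where
  "hecke_coeff p n = ramanujan_tau (p * n) +
     (if p dvd n then int p ^ 11 * ramanujan_tau (n div p) else 0)"

lemma hecke_sums:
  assumes p: "p > 0" and z: "Im z > 0"
  shows "(\<lambda>n. of_int (hecke_coeff p n) * nome z ^ n) sums hecke p z"
proof -
  \<comment> \<open>The series of the discriminant at p z, its coefficients spread out over the
    multiples of p.\<close>
  define f where "f n = (if p dvd n then of_int (ramanujan_tau (n div p)) * nome z ^ n else 0)" for n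
  have "(\<lambda>n. f (p * n)) sums cusp_disc (of_nat p * z)"
    using cusp_disc_sums[of "of_nat p * z"] z p
    by (simp add: f_def power_mult nome_power)
  then have 1: "f sums cusp_disc (of_nat p * z)"
    using sums_multiples_iff[OF p, of f] by (simp add: f_def)
  define g where "g n = (\<Sum>b<p. of_int (ramanujan_tau n) * nome ((z + of_nat b) / of_nat p) ^ n)" for n
  have g_eq: "g n = of_int (ramanujan_tau n) * nome (z / of_nat p) ^ n * (if p dvd n then of_nat p else 0)" for n
  proof -
    have "nome ((z + of_nat b) / of_nat p) ^ n = nome (z / of_nat p) ^ n * nome (of_nat n / of_nat p) ^ b" for b
      unfolding nome_power nome_add[symmetric]
      by (rule arg_cong[where f = nome]) (simp add: add_divide_distrib ring_distribs mult_ac)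
    then show ?thesis
      unfolding g_def sum_nome_roots_of_unity[OF p, symmetric] by (simp add: sum_distrib_left mult_ac)
  qed
  have "g sums (\<Sum>b<p. cusp_disc ((z + of_nat b) / of_nat p))"
    unfolding g_def using z p by (intro sums_sum cusp_disc_sums) (simp add: Im_divide_of_nat)
  then have "(\<lambda>n. g (p * n)) sums (\<Sum>b<p. cusp_disc ((z + of_nat b) / of_nat p))"
    using sums_multiples_iff[OF p, of g] by (simp add: g_eq)
  moreover have "g (p * n) = of_int (ramanujan_tau (p * n)) * nome z ^ n * of_nat p" for n
    using p by (simp add: g_eq power_mult nome_power)
  ultimately have 2: "(\<lambda>n. of_int (ramanujan_tau (p * n)) * nome z ^ n) sums
      ((\<Sum>b<p. cusp_disc ((z + of_nat b) / of_nat p)) / of_nat p)"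
    using sums_divide[of "\<lambda>n. g (p * n)" _ "of_nat p"] p by simp
  have "(\<lambda>n. of_nat p ^ 11 * f n + of_int (ramanujan_tau (p * n)) * nome z ^ n) sums hecke p z"
    unfolding hecke_def by (intro sums_add sums_mult 1 2)
  moreover have "of_nat p ^ 11 * f n + of_int (ramanujan_tau (p * n)) * nome z ^ n =
      of_int (hecke_coeff p n) * nome z ^ n" for n
    by (simp add: f_def hecke_coeff_def algebra_simps)
  ultimately show ?thesis
    by simp
qed

section \<open>Invariant functions on the unit disc\<close>

lemma nome_surj:
  assumes "x \<noteq> 0"
  obtains z where "nome z = x"
proof -
  have "nome (Ln x / (2 * of_real pi * \<i>)) = x"
    using assms by (simp add: nome_def expi_def)
  then show ?thesis
    using that by blast
qed

lemma norm_nome_less_1_iff: "norm (nome z) < 1 \<longleftrightarrow> Im z > 0"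
  by (simp add: norm_nome zero_less_mult_iff)

text \<open>If \<open>\<bar>Re w\<bar> \<le> 1/2\<close> and \<open>Im w < 1/2\<close>, then inversion at least doubles the imaginary part.\<close>
lemma exists_equivalent_high_point:
  fixes G :: "complex \<Rightarrow> 'a"
  assumes z: "Im z > 0"
    and trans: "\<And>w n. G (w + of_int n) = G w"
    and inv: "\<And>w. Im w > 0 \<Longrightarrow> G (-1 / w) = G w"
  obtains w where "Im w \<ge> 1/2" "G w = G z"
proof -
  \<comment> \<open>N bounds the number of inversions still needed, as each doubles the imaginary
    part; the induction is on N.\<close>
  obtain N :: nat where "(1/2) / Im z < 2 ^ N"
    using real_arch_pow[of 2] by auto
  then have "2 ^ N * Im z \<ge> 1/2"
    using z by (simp add: field_simps)
  with z have "\<exists>w. Im w \<ge> 1/2 \<and> G w = G z"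
  proof (induction N arbitrary: z)
    case (Suc N)
    define w where "w = z + of_int (- round (Re z))"
    have Re_w: "\<bar>Re w\<bar> \<le> 1/2"
      using of_int_round_abs_le[of "Re z"] by (simp add: w_def abs_minus_commute)
    have w: "Im w = Im z" "G w = G z"
      using trans by (simp_all add: w_def del: of_int_minus)
    show ?case
    proof (cases "Im w \<ge> 1/2")
      case False
      have "(Re w)\<^sup>2 \<le> (1/2)\<^sup>2" "(Im w)\<^sup>2 \<le> (1/2)\<^sup>2"
        using Re_w False Suc.prems w by (auto simp: abs_le_square_iff[symmetric])
      then have "(norm w)\<^sup>2 \<le> 1/2"
        by (simp add: cmod_power2 power_divide)
      moreover have "(norm w)\<^sup>2 > 0"
        using Suc.prems w by auto
      ultimately have "2 * Im w \<le> Im (-1 / w)"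
        unfolding Im_minus_inverse using Suc.prems w by (simp add: field_simps)
      then have "2 ^ N * (2 * Im z) \<le> 2 ^ N * Im (-1 / w)"
        using w by (intro mult_left_mono) auto
      then have "1/2 \<le> 2 ^ N * Im (-1 / w)"
        using Suc.prems by (simp add: mult_ac)
      moreover have "Im (-1 / w) > 0"
        using Suc.prems w by (intro Im_minus_inverse_pos) simp
      ultimately obtain u where "Im u \<ge> 1/2" "G u = G (-1 / w)"
        using Suc.IH by blast
      then show ?thesis
        using inv[of w] w Suc.prems by auto
    qed (use w in auto)
  qed auto
  then show ?thesis
    using that by blast
qed

theorem modular_function_constant:
  assumes hol: "F holomorphic_on ball 0 1"
    and inv: "\<And>z. Im z > 0 \<Longrightarrow> F (nome (-1 / z)) = F (nome z)"
    and x: "norm x < 1"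
  shows "F x = F 0"
proof -
  \<comment> \<open>The modulus of \<open>nome w\<close> at Im w = 1/2: every orbit meets the closed
    disc of radius \<rho>, so a maximum of |F| there is one over the whole open disc.\<close>
  define \<rho> where "\<rho> = exp (- pi)"
  have \<rho>: "0 < \<rho>" "\<rho> < 1"
    by (simp_all add: \<rho>_def)
  then have sub: "cball (0::complex) \<rho> \<subseteq> ball 0 1"
    by auto
  have "continuous_on (cball 0 \<rho>) (\<lambda>x. norm (F x))"
    using holomorphic_on_imp_continuous_on[OF hol] sub by (auto intro!: continuous_intros intro: continuous_on_subset)
  then obtain x0 where x0: "x0 \<in> cball 0 \<rho>" "\<And>x. x \<in> cball 0 \<rho> \<Longrightarrow> norm (F x) \<le> norm (F x0)"
    using continuous_attains_sup[of "cball 0 \<rho>" "\<lambda>x. norm (F x)"] \<rho> by auto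
  have "norm (F x) \<le> norm (F x0)" if "x \<in> ball 0 1" for x
  proof (cases "x = 0")
    case True
    then show ?thesis
      using x0 \<rho> by simp
  next
    case False
    then obtain z where z: "nome z = x"
      using nome_surj by blast
    have "Im z > 0"
      using that z norm_nome_less_1_iff[of z] by simp
    then obtain w where w: "Im w \<ge> 1/2" "F (nome w) = F (nome z)"
      using exists_equivalent_high_point[of z "\<lambda>z. F (nome z)"] inv by (auto simp: nome_add)
    have "norm (nome w) \<le> \<rho>"
      using w by (simp add: norm_nome \<rho>_def)
    then show ?thesis
      using x0(2)[of "nome w"] w z by simp
  qed
  then have "F constant_on ball 0 1"
    using x0 sub by (intro maximum_modulus_principle[OF hol, of "ball 0 1" x0]) auto
  then show ?thesis
    using x unfolding constant_on_def by (metis centre_in_ball mem_ball_0 zero_less_one)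
qed

section \<open>Comparison of coefficients\<close>

lemma holomorphic_qpoch_diag: "(\<lambda>x. qpoch x x) holomorphic_on ball 0 1"
  using holomorphic_prodinf_one_minus_power by (simp add: qpoch_def[abs_def])

text \<open>After division of the series by x, its constant term is the value at 0 of the product.
  The series is divided for x \<noteq> 0 only, hence the passage to the limit.\<close>

lemma ramanujan_tau_1 [simp]: "ramanujan_tau 1 = 1"
proof -
  define f where "f x = qpoch x x ^ 24" for x
  have "(\<lambda>k. of_int (ramanujan_tau (Suc k)) * x ^ k) sums f x" if "x \<noteq> 0" "norm x < 1" for x
  proof -
    have "(\<lambda>k. of_int (ramanujan_tau (Suc k)) * x ^ Suc k / x) sums (x * f x / x)"
      using ramanujan_tau_power_series[OF that(2)] sums_Suc_iff[of "\<lambda>k. of_int (ramanujan_tau k) * x ^ k"]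
      by (intro sums_divide) (simp add: f_def ramanujan_tau_0)
    then show ?thesis
      using that by simp
  qed
  then have "(f \<longlongrightarrow> of_int (ramanujan_tau (Suc 0))) (at 0)"
    by (intro powser_limit_0_strong[of 1]) auto
  moreover have "f holomorphic_on ball 0 1"
    unfolding f_def by (intro holomorphic_intros holomorphic_qpoch_diag)
  then have "(f \<longlongrightarrow> f 0) (at 0)"
    using holomorphic_on_imp_continuous_on[of f "ball 0 1"]
    by (simp add: continuous_on_eq_continuous_at isCont_def)
  ultimately have "of_int (ramanujan_tau (Suc 0)) = f 0"
    by (intro tendsto_unique[of "at 0" f]) auto
  then show ?thesis
    by (simp add: f_def)
qed

theorem ramanujan_tau_hecke:
  assumes p: "prime p"
  shows "ramanujan_tau p * ramanujan_tau n = hecke_coeff p n"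
proof -
  have p0: "p > 0"
    using p by (simp add: prime_gt_0_nat)
  define c where "c n = complex_of_int (hecke_coeff p n)" for n
  have c0: "c 0 = 0" and c1: "c 1 = of_int (ramanujan_tau p)"
    using p by (auto simp: c_def hecke_coeff_def ramanujan_tau_0)
  \<comment> \<open>Since c 0 = 0, one factor q can be divided out of the series of
    \<open>hecke p\<close>.\<close>
  define g where "g x = (\<Sum>n. c (Suc n) * x ^ n)" for x
  have g_sums: "(\<lambda>n. c (Suc n) * x ^ n) sums g x" if "norm x < 1" for x
  proof (cases "x = 0")
    case True
    then show ?thesis
      unfolding g_def by (intro summable_sums) (auto simp: power_0_left split: if_splits intro!: summable_finite[of "{0}"])
  next
    case False
    then obtain z where z: "nome z = x"
      using nome_surj by blast
    then have "summable (\<lambda>n. c n * x ^ n)"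
      using hecke_sums[OF p0, of z] that norm_nome_less_1_iff[of z] by (auto simp: c_def sums_iff)
    then have "summable (\<lambda>n. c (Suc n) * x ^ Suc n / x)"
      by (intro summable_divide) (subst summable_Suc_iff)
    then show ?thesis
      unfolding g_def using False by (intro summable_sums) simp
  qed
  have c_sums: "(\<lambda>n. c n * x ^ n) sums (x * g x)" if "norm x < 1" for x
    using sums_mult[OF g_sums[OF that], of x] sums_Suc_iff[of "\<lambda>n. c n * x ^ n"] c0
    by (simp add: mult_ac)
  have hecke_g: "hecke p z = nome z * g (nome z)" if "Im z > 0" for z
    using c_sums[OF norm_nome_less_1[OF that]] hecke_sums[OF p0 that]
    unfolding c_def by (rule sums_unique2[symmetric])
  \<comment> \<open>The quotient of \<open>hecke p\<close> by the discriminant with the common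
    factor q cancelled, which makes it holomorphic at q = 0 as well.\<close>
  define F where "F x = g x / qpoch x x ^ 24" for x
  have F_eq: "F (nome z) = hecke p z / cusp_disc z" if "Im z > 0" for z
    using hecke_g[OF that] by (simp add: F_def cusp_disc_def)
  have "g holomorphic_on ball 0 1"
    by (rule power_series_holomorphic[of 0 1 "\<lambda>n. c (Suc n)"]) (use g_sums in auto)
  then have "F holomorphic_on ball 0 1"
    unfolding F_def by (intro holomorphic_intros holomorphic_qpoch_diag) (auto simp: qpoch_nonzero')
  moreover have "F (nome (-1 / z)) = F (nome z)" if "Im z > 0" for z
  proof -
    have "z \<noteq> 0"
      using that by auto
    then show ?thesis
      unfolding F_eq[OF that] F_eq[OF Im_minus_inverse_pos[OF that]]
        hecke_minus_inverse[OF p that] cusp_disc_minus_inverse[OF that] by simp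
  qed
  ultimately have F_const: "F x = F 0" if "norm x < 1" for x
    using modular_function_constant that by blast
  \<comment> \<open>The constant F 0 is the leading coefficient c 1, and c 1 = \<tau>(p) because p
    does not divide 1.\<close>
  have "g 0 = c 1"
    using g_sums[of 0] powser_sums_zero_iff[of "\<lambda>n. c (Suc n)" "g 0"] by simp
  then have "F 0 = of_int (ramanujan_tau p)"
    using c1 by (simp add: F_def)
  then have g_eq: "g x = of_int (ramanujan_tau p) * qpoch x x ^ 24" if "norm x < 1" for x
    using F_const[OF that] qpoch_nonzero'[OF that that] by (simp add: F_def field_simps)
  define h where "h x = x * g x" for x
  have "h has_fps_expansion Abs_fps c"
    by (rule has_fps_expansionI)
       (use c_sums in \<open>auto simp: h_def eventually_nhds intro!: exI[of _ "ball 0 1"]\<close>)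
  moreover have "(\<lambda>k. of_int (ramanujan_tau p * ramanujan_tau k) * x ^ k) sums h x" if "norm x < 1" for x
    using sums_mult[OF ramanujan_tau_power_series[OF that], of "of_int (ramanujan_tau p)"]
    by (simp add: h_def g_eq[OF that] mult_ac)
  then have "h has_fps_expansion Abs_fps (\<lambda>k. of_int (ramanujan_tau p * ramanujan_tau k))"
    by (intro has_fps_expansionI) (auto simp: eventually_nhds intro!: exI[of _ "ball 0 1"])
  ultimately have "Abs_fps c = Abs_fps (\<lambda>k. of_int (ramanujan_tau p * ramanujan_tau k))"
    by (rule fps_expansion_unique_complex)
  then have "c n = of_int (ramanujan_tau p * ramanujan_tau n)"
    by (metis fps_nth_Abs_fps)
  then show ?thesis
    unfolding c_def by (metis of_int_eq_iff)
qed

text \<open>The Hecke relation at n = p^(k+1), where n/p = p^k.\<close>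

corollary ramanujan_tau_prime_power_Suc:
  assumes "prime p"
  shows "ramanujan_tau (p ^ Suc (Suc k)) =
    ramanujan_tau p * ramanujan_tau (p ^ Suc k) - int p ^ 11 * ramanujan_tau (p ^ k)"
  using ramanujan_tau_hecke[OF assms, of "p ^ Suc k"] prime_gt_0_nat[OF assms]
  by (simp add: hecke_coeff_def)

theorem corollary2:
  fixes p m n :: nat
  assumes "prime p" and "m \<ge> 1" and "n \<ge> 1"
  shows "ramanujan_tau (p ^ (m + n)) =
    ramanujan_tau (p ^ m) * ramanujan_tau (p ^ n)
      - int p ^ 11 * ramanujan_tau (p ^ (m - 1)) * ramanujan_tau (p ^ (n - 1))"
proof -
  define t where "t k = ramanujan_tau (p ^ k)" for k
  have rec: "t (Suc (Suc k)) = t 1 * t (Suc k) - int p ^ 11 * t k" for k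
    using ramanujan_tau_prime_power_Suc[OF assms(1), of k] by (simp add: t_def)
  \<comment> \<open>The induction moves one unit from the first exponent to the second and applies
    the recurrence to both; the base case is the recurrence itself, as t 0 = 1.\<close>
  have "t (Suc i + Suc j) = t (Suc i) * t (Suc j) - int p ^ 11 * t i * t j" for i j
  proof (induction i arbitrary: j)
    case 0
    then show ?case
      using rec[of j] ramanujan_tau_1 by (simp add: t_def del: One_nat_def)
  next
    case (Suc i)
    have "t (Suc (Suc i) + Suc j) = t (Suc i + Suc (Suc j))"
      by simp
    also have "\<dots> = t (Suc i) * (t 1 * t (Suc j) - int p ^ 11 * t j) - int p ^ 11 * t i * t (Suc j)"
      unfolding Suc.IH rec ..
    also have "\<dots> = t (Suc (Suc i)) * t (Suc j) - int p ^ 11 * t (Suc i) * t j"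
      unfolding rec[of i] by (simp add: algebra_simps)
    finally show ?case .
  qed
  from this[of "m - 1" "n - 1"] show ?thesis
    using assms(2,3) by (simp add: t_def)
qed

end
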